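(* Let $G$ be a 2-connected cubic graph and $u$ a vertex of $G$. Then $u$ is not nice in $G$ if and only if there exists a barrier $S$ of $G$ such that $u$ is an isolated vertex of $G-S$.
   Context: All graphs are finite, simple and connected. A vertex $u$ of a cubic graph $G$ is nice if $G-N_G[u]$ has a perfect matching, where $N_G[u]$ is the closed neighbourhood. For a graph $G$ with a perfect matching, a barrier is a set $S\subseteq V(G)$ with $o(G-S)=|S|$, where $o(\cdot)$ is the number of odd components. *)

theory Defs
  imports "Graph_Theory.Digraph_Component"
begin

text \<open>
  A finite simple graph is an instance of the locale \<^locale>\<open>graph\<close>: a finite symmetric
  digraph without loops or parallel arcs. An undirected edge is thus a pair of opposite arcs,
  the number of edges at a vertex is its \<^const>\<open>out_degree\<close>, and the connected components are
  the strongly connected components \<^const>\<open>pre_digraph.sccs\<close>.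
\<close>

definition neighbours :: "('a,'b) pre_digraph \<Rightarrow> 'a \<Rightarrow> 'a set" where
  "neighbours G u = {v. u \<rightarrow>\<^bsub>G\<^esub> v}"

definition closed_neighbours :: "('a,'b) pre_digraph \<Rightarrow> 'a \<Rightarrow> 'a set" where
  "closed_neighbours G u = insert u (neighbours G u)"

definition delete_verts :: "('a,'b) pre_digraph \<Rightarrow> 'a set \<Rightarrow> ('a,'b) pre_digraph" where
  "delete_verts G S = G \<restriction> (verts G - S)"

definition isolated_vertex :: "('a,'b) pre_digraph \<Rightarrow> 'a \<Rightarrow> bool" where
  "isolated_vertex G u \<longleftrightarrow> u \<in> verts G \<and> neighbours G u = {}"

definition cubic :: "('a,'b) pre_digraph \<Rightarrow> bool" where
  "cubic G \<longleftrightarrow> (\<forall>v \<in> verts G. out_degree G v = 3)"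

definition k_connected :: "nat \<Rightarrow> ('a,'b) pre_digraph \<Rightarrow> bool" where
  "k_connected k G \<longleftrightarrow> k < card (verts G) \<and>
     (\<forall>X \<subseteq> verts G. card X < k \<longrightarrow> Digraph_Component.connected (delete_verts G X))"

definition edges :: "('a,'b) pre_digraph \<Rightarrow> 'a set set" where
  "edges G = {{u, v} | u v. u \<rightarrow>\<^bsub>G\<^esub> v}"

text \<open>The graph without vertices has the perfect matching \<open>{}\<close>.\<close>

definition perfect_matching :: "('a,'b) pre_digraph \<Rightarrow> 'a set set \<Rightarrow> bool" where
  "perfect_matching G M \<longleftrightarrow> M \<subseteq> edges G \<and> (\<forall>v \<in> verts G. \<exists>!e. e \<in> M \<and> v \<in> e)"

definition has_perfect_matching :: "('a,'b) pre_digraph \<Rightarrow> bool" where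
  "has_perfect_matching G \<longleftrightarrow> (\<exists>M. perfect_matching G M)"

definition nice :: "('a,'b) pre_digraph \<Rightarrow> 'a \<Rightarrow> bool" where
  "nice G u \<longleftrightarrow> has_perfect_matching (delete_verts G (closed_neighbours G u))"

definition odd_components :: "('a,'b) pre_digraph \<Rightarrow> ('a,'b) pre_digraph set" where
  "odd_components G = {C \<in> pre_digraph.sccs G. odd (card (verts C))}"

text \<open>
  Barriers are only defined for graphs with a perfect matching, so the existence of one is
  part of the predicate.
\<close>

definition barrier :: "('a,'b) pre_digraph \<Rightarrow> 'a set \<Rightarrow> bool" where
  "barrier G S \<longleftrightarrow> has_perfect_matching G \<and> S \<subseteq> verts G \<and>
     card (odd_components (delete_verts G S)) = card S"

end

theory Submission
  imports Defs
begin

text \<open>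
  Let \<open>N\<close> be the neighbourhood of \<open>u\<close>. Removing \<open>S \<supseteq> N\<close> from \<open>G\<close> leaves the isolated vertex \<open>u\<close>
  and the graph obtained from \<open>H = G - N[u]\<close> by removing \<open>S - N\<close>, so that the number of odd components
  differs by one while the removed sets differ by three elements. Hence a barrier isolating \<open>u\<close>
  violates Tutte's condition for \<open>H\<close>. Conversely, \<open>H\<close> has an even number of vertices, so a violation
  in \<open>H\<close> is one by at least two, and adding \<open>N\<close> to it gives \<open>|S|\<close> odd components in \<open>G - S\<close>.
  There are no more than that, because \<open>G\<close> has a perfect matching by Petersen's theorem.

  Tutte's theorem is proved by induction. If \<open>S\<close> is maximal with exactly \<open>|S|\<close> odd components left,
  then every component of \<open>G - S\<close> is odd and remains matchable after the loss of any one vertex, and Hall's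
  theorem matches the components with \<open>S\<close>.
\<close>

section \<open>Hall's theorem\<close>

text \<open>The induction splits on whether some nonempty proper \<open>J\<close> is tight. If so,
  \<open>J\<close> and \<open>I - J\<close> are solved separately, the latter avoiding the sets of
  \<open>J\<close>. If not, every nonempty proper subfamily has an element to spare, so one index
  may take any representative.\<close>

lemma hall:
  fixes A :: "'i \<Rightarrow> 'a set"
  assumes "finite I" "\<And>i. i \<in> I \<Longrightarrow> finite (A i)"
    and "\<And>J. J \<subseteq> I \<Longrightarrow> card J \<le> card (\<Union>(A ` J))"
  shows "\<exists>R. (\<forall>i\<in>I. R i \<in> A i) \<and> inj_on R I"
  using assms
proof (induction I arbitrary: A rule: finite_psubset_induct)
  case (psubset I)
  note fin = psubset.prems(1) and hall = psubset.prems(2)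
  have finU: "finite (\<Union>(A ` J))" if "J \<subseteq> I" for J
    using that fin psubset.hyps by (meson finite_UN finite_subset subsetD)
  show ?case
  proof (cases "\<exists>J. J \<subset> I \<and> J \<noteq> {} \<and> card (\<Union>(A ` J)) = card J")
    case True
    then obtain J where J: "J \<subset> I" "J \<noteq> {}" "card (\<Union>(A ` J)) = card J" by blast
    let ?U = "\<Union>(A ` J)"
    have finJ: "finite J" using J psubset.hyps finite_subset by blast
    have "\<exists>R. (\<forall>i\<in>J. R i \<in> A i) \<and> inj_on R J"
      using psubset.IH[of J A] J fin hall by blast
    then obtain R where R: "\<And>i. i \<in> J \<Longrightarrow> R i \<in> A i" "inj_on R J" by blast
    have "\<exists>Q. (\<forall>i\<in>I - J. Q i \<in> A i - ?U) \<and> inj_on Q (I - J)"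
    proof (rule psubset.IH)
      show "I - J \<subset> I" using J by blast
      show "finite (A i - ?U)" if "i \<in> I - J" for i using that fin by blast
      show "card K \<le> card (\<Union>i\<in>K. A i - ?U)" if "K \<subseteq> I - J" for K
      proof -
        have finK: "finite K" using that psubset.hyps finite_subset by blast
        have sub: "K \<union> J \<subseteq> I" using that J by blast
        \<comment> \<open>Since \<open>?U\<close> has exactly \<open>card J\<close> elements, Hall's
          condition for \<open>K \<union> J\<close> yields the one for \<open>K\<close> after
          removing \<open>?U\<close>.\<close>
        have "card K + card J = card (K \<union> J)"
          using that finK finJ by (subst card_Un_disjoint) auto
        also have "\<dots> \<le> card (\<Union>(A ` (K \<union> J)))" using hall sub by blast
        also have "\<Union>(A ` (K \<union> J)) = (\<Union>i\<in>K. A i - ?U) \<union> ?U" by blast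
        also have "card \<dots> \<le> card (\<Union>i\<in>K. A i - ?U) + card ?U" by (rule card_Un_le)
        finally show ?thesis using J(3) by simp
      qed
    qed
    then obtain Q where Q: "\<And>i. i \<in> I - J \<Longrightarrow> Q i \<in> A i - ?U" "inj_on Q (I - J)" by blast
    let ?R = "\<lambda>i. if i \<in> J then R i else Q i"
    have "inj_on ?R I"
    proof (rule inj_onI)
      fix x y assume "x \<in> I" "y \<in> I" "?R x = ?R y"
      then show "x = y" using R(1)[of x] R(1)[of y] Q(1)[of x] Q(1)[of y] inj_onD[OF R(2), of x y] inj_onD[OF Q(2), of x y]
        by (cases "x \<in> J"; cases "y \<in> J") auto
    qed
    moreover have "\<forall>i\<in>I. ?R i \<in> A i" using R(1) Q(1) by auto
    ultimately show ?thesis by (intro exI[of _ ?R]) simp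
  next
    case False
    show ?thesis
    proof (cases "I = {}")
      case True then show ?thesis by simp
    next
      case ne: False
      then obtain i where i: "i \<in> I" by blast
      have "card {i} \<le> card (A i)" using hall[of "{i}"] i by simp
      then obtain a where a: "a \<in> A i" by fastforce
      have "\<exists>Q. (\<forall>j\<in>I - {i}. Q j \<in> A j - {a}) \<and> inj_on Q (I - {i})"
      proof (rule psubset.IH)
        show "I - {i} \<subset> I" using i by blast
        show "finite (A j - {a})" if "j \<in> I - {i}" for j using that fin by blast
        show "card K \<le> card (\<Union>j\<in>K. A j - {a})" if K: "K \<subseteq> I - {i}" for K
        proof (cases "K = {}")
          case True then show ?thesis by simp
        next
          case Kne: False
          have KI: "K \<subset> I" using K i by blast
          then have "card K \<le> card (\<Union>(A ` K))" using hall by blast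
          \<comment> \<open>In the absence of tight subfamilies the bound is strict, and the surplus
            of one pays for the loss of \<open>a\<close>.\<close>
          moreover have "card (\<Union>(A ` K)) \<noteq> card K" using False KI Kne by blast
          moreover have "card (\<Union>(A ` K)) \<le> card (insert a (\<Union>j\<in>K. A j - {a}))"
            by (rule card_mono) (use finU[of K] KI in \<open>auto elim: finite_subset[rotated]\<close>)
          moreover have "card (insert a (\<Union>j\<in>K. A j - {a})) \<le> Suc (card (\<Union>j\<in>K. A j - {a}))"
            by (rule card_insert_le_m1) auto
          ultimately show ?thesis by linarith
        qed
      qed
      then obtain Q where Q: "\<And>j. j \<in> I - {i} \<Longrightarrow> Q j \<in> A j - {a}" "inj_on Q (I - {i})" by blast
      have "inj_on (Q(i := a)) I"
      proof (rule inj_onI)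
        fix x y assume "x \<in> I" "y \<in> I" "(Q(i := a)) x = (Q(i := a)) y"
        then show "x = y" using Q(1)[of x] Q(1)[of y] inj_onD[OF Q(2), of x y]
          by (cases "x = i"; cases "y = i") auto
      qed
      moreover have "\<forall>j\<in>I. (Q(i := a)) j \<in> A j" using Q(1) a by auto
      ultimately show ?thesis by blast
    qed
  qed
qed

section \<open>Components and matchings of symmetric relations\<close>

text \<open>The orbits \<open>{x, f x}\<close> have two elements each and are removed one at a
  time.\<close>

lemma even_card_if_fixpoint_free_involution:
  assumes "finite A" "\<And>x. x \<in> A \<Longrightarrow> f x \<in> A" "\<And>x. x \<in> A \<Longrightarrow> f (f x) = x"
    and "\<And>x. x \<in> A \<Longrightarrow> f x \<noteq> x"
  shows "even (card A)"
  using assms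
proof (induction A rule: finite_psubset_induct)
  case (psubset A)
  show ?case
  proof (cases "A = {}")
    case False
    then obtain x where x: "x \<in> A" by blast
    have fx: "f x \<in> A" "f x \<noteq> x" using psubset.prems x by blast+
    have "even (card (A - {x, f x}))"
    proof (rule psubset.IH)
      show "f y \<in> A - {x, f x}" if "y \<in> A - {x, f x}" for y
        using that psubset.prems(1,2) x by (metis DiffE DiffI insertCI insertE singletonD)
    qed (use x psubset.prems in auto)
    moreover have "card A = card (A - {x, f x}) + 2"
      using card_Diff_subset[of "{x, f x}" A] card_mono[OF psubset.hyps, of "{x, f x}"] x fx by simp
    ultimately show ?thesis by simp
  qed simp
qed

text \<open>
  A graph is given by an adjacency relation \<open>E\<close> and a vertex set \<open>U\<close>, so that a vertex-deleted subgraph only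
  changes \<open>U\<close>. Components are minimal nonempty closed sets rather than reachability classes, which
  avoids paths; a perfect matching is the involution exchanging the ends of its edges.
\<close>

definition closed_in :: "('a \<Rightarrow> 'a \<Rightarrow> bool) \<Rightarrow> 'a set \<Rightarrow> 'a set \<Rightarrow> bool" where
  "closed_in E U W \<longleftrightarrow> W \<subseteq> U \<and> (\<forall>x\<in>W. \<forall>y\<in>U. E x y \<longrightarrow> y \<in> W)"

definition comps :: "('a \<Rightarrow> 'a \<Rightarrow> bool) \<Rightarrow> 'a set \<Rightarrow> 'a set set" where
  "comps E U = {C. closed_in E U C \<and> C \<noteq> {} \<and>
     (\<forall>D. closed_in E U D \<and> D \<noteq> {} \<and> D \<subseteq> C \<longrightarrow> D = C)}"

definition odd_comps :: "('a \<Rightarrow> 'a \<Rightarrow> bool) \<Rightarrow> 'a set \<Rightarrow> 'a set set" where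
  "odd_comps E U = {C \<in> comps E U. odd (card C)}"

definition matchable :: "('a \<Rightarrow> 'a \<Rightarrow> bool) \<Rightarrow> 'a set \<Rightarrow> bool" where
  "matchable E U \<longleftrightarrow> (\<exists>f. \<forall>x\<in>U. f x \<in> U \<and> E x (f x) \<and> f (f x) = x)"

section \<open>Components as minimal closed sets\<close>

lemma comps_subset: "C \<in> comps E U \<Longrightarrow> C \<subseteq> U"
  by (simp add: comps_def closed_in_def)

lemma comps_nonempty: "C \<in> comps E U \<Longrightarrow> C \<noteq> {}"
  by (simp add: comps_def)

lemma comps_closed: "C \<in> comps E U \<Longrightarrow> closed_in E U C"
  by (simp add: comps_def)

lemma comps_minimal: "C \<in> comps E U \<Longrightarrow> closed_in E U D \<Longrightarrow> D \<noteq> {} \<Longrightarrow> D \<subseteq> C \<Longrightarrow> D = C"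
  by (simp add: comps_def)

lemma closed_in_Int: "closed_in E U C \<Longrightarrow> closed_in E U D \<Longrightarrow> closed_in E U (C \<inter> D)"
  by (auto simp: closed_in_def)

lemma closed_in_closed:
  assumes "closed_in E U W" "D \<subseteq> W"
  shows "closed_in E W D \<longleftrightarrow> closed_in E U D"
  using assms by (fastforce simp: closed_in_def)

lemma finite_comps: "finite U \<Longrightarrow> finite (comps E U)"
  using comps_subset[of _ E U] by (auto intro: finite_subset[of _ "Pow U"])

lemma finite_odd_comps: "finite U \<Longrightarrow> finite (odd_comps E U)"
  by (simp add: odd_comps_def finite_comps)

lemma comps_disjoint:
  assumes "C \<in> comps E U" "D \<in> comps E U" "C \<noteq> D"
  shows "C \<inter> D = {}"
  using assms closed_in_Int[of E U C D] comps_minimal[of C E U "C \<inter> D"]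
    comps_minimal[of D E U "C \<inter> D"] comps_closed[of _ E U] by blast

text \<open>Subsets of a closed \<open>W\<close> are closed in \<open>W\<close> exactly when they
  are closed in \<open>U\<close>, so minimality means the same in both.\<close>

lemma comps_closed_iff:
  assumes "closed_in E U W" "C \<subseteq> W"
  shows "C \<in> comps E U \<longleftrightarrow> C \<in> comps E W"
  using assms closed_in_closed[OF assms(1)] unfolding comps_def mem_Collect_eq
  by (metis subset_trans)

lemma comps_of_comp: "C \<in> comps E U \<Longrightarrow> comps E C = {C}"
proof -
  assume C: "C \<in> comps E U"
  then have CC: "C \<in> comps E C" using comps_closed_iff[OF comps_closed[OF C], of C] by blast
  have "D = C" if D: "D \<in> comps E C" for D
    using comps_minimal[OF CC comps_closed[OF D] comps_nonempty[OF D] comps_subset[OF D]] .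
  then show "comps E C = {C}" using CC by blast
qed

section \<open>Decomposition into components and parity\<close>

context
  fixes E :: "'a \<Rightarrow> 'a \<Rightarrow> bool"
  assumes sym: "symp E"
begin

text \<open>Here symmetry enters: an edge from \<open>U - W\<close> into \<open>W\<close>, reversed,
  would leave \<open>W\<close>.\<close>

lemma closed_in_Diff: "closed_in E U W \<Longrightarrow> closed_in E U (U - W)"
  using sym by (auto simp: closed_in_def dest: sympD)

text \<open>The component of \<open>x\<close> is the intersection of all closed sets containing
  \<open>x\<close>.\<close>

lemma comp_exists:
  assumes "x \<in> U"
  obtains C where "C \<in> comps E U" "x \<in> C"
proof
  let ?C = "\<Inter>{W. closed_in E U W \<and> x \<in> W}"
  have U: "closed_in E U U" by (auto simp: closed_in_def)
  show x: "x \<in> ?C" by blast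
  have "closed_in E U ?C" using U assms unfolding closed_in_def by blast
  moreover have "D = ?C" if "closed_in E U D" "D \<noteq> {}" "D \<subseteq> ?C" for D
  proof (cases "x \<in> D")
    case False
    \<comment> \<open>The complement of \<open>D\<close> is one of the intersected sets, so
      \<open>?C\<close> would miss its nonempty subset \<open>D\<close>.\<close>
    then have "?C \<subseteq> U - D" using closed_in_Diff[OF that(1)] assms by blast
    then show ?thesis using that by blast
  qed (use that in blast)
  ultimately show "?C \<in> comps E U" using x unfolding comps_def by blast
qed

lemma Union_comps: "\<Union>(comps E U) = U"
proof
  show "U \<subseteq> \<Union>(comps E U)" by (meson UnionI comp_exists subsetI)
qed (use comps_subset in blast)

text \<open>The part of a component inside \<open>W\<close> is closed, so by minimality it is empty
  or the whole component.\<close>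

lemma comps_split:
  assumes "closed_in E U W"
  shows "comps E U = comps E W \<union> comps E (U - W)"
proof -
  have cases: "C \<subseteq> W \<or> C \<subseteq> U - W" if "C \<in> comps E U" for C
    using comps_minimal[OF that closed_in_Int[OF comps_closed[OF that] assms]] comps_subset[OF that]
    by blast
  show ?thesis
  proof (intro equalityI subsetI)
    fix C assume C: "C \<in> comps E U"
    from cases[OF C] show "C \<in> comps E W \<union> comps E (U - W)"
    proof
      assume "C \<subseteq> W"
      then show ?thesis using C comps_closed_iff[OF assms] by blast
    next
      assume "C \<subseteq> U - W"
      then show ?thesis using C comps_closed_iff[OF closed_in_Diff[OF assms]] by blast
    qed
  next
    fix C assume "C \<in> comps E W \<union> comps E (U - W)"
    then show "C \<in> comps E U"
    proof
      assume C: "C \<in> comps E W"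
      then show ?thesis using comps_closed_iff[OF assms comps_subset[OF C]] by blast
    next
      assume C: "C \<in> comps E (U - W)"
      then show ?thesis using comps_closed_iff[OF closed_in_Diff[OF assms] comps_subset[OF C]] by blast
    qed
  qed
qed

lemma card_odd_comps_split:
  assumes "finite U" "closed_in E U W"
  shows "card (odd_comps E U) = card (odd_comps E W) + card (odd_comps E (U - W))"
proof -
  have "finite W" using assms finite_subset unfolding closed_in_def by blast
  moreover have "odd_comps E U = odd_comps E W \<union> odd_comps E (U - W)"
    using comps_split[OF assms(2)] by (auto simp: odd_comps_def)
  moreover have "odd_comps E W \<inter> odd_comps E (U - W) = {}"
    using comps_nonempty[of _ E W] comps_subset[of _ E W] comps_subset[of _ E "U - W"]
    unfolding odd_comps_def by blast
  ultimately show ?thesis using assms by (simp add: card_Un_disjoint finite_odd_comps)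
qed

text \<open>Deleting vertices of one component leaves the other components untouched. Tutte's
  theorem uses this to study a single component of \<open>U - S\<close>.\<close>

lemma card_odd_comps_Diff:
  assumes "finite U" "C \<in> comps E U" "X \<subseteq> C"
  shows "card (odd_comps E (U - X)) = card (odd_comps E (C - X)) + card (odd_comps E (U - C))"
proof -
  have "closed_in E (U - X) (C - X)" using comps_closed[OF assms(2)] by (auto simp: closed_in_def)
  moreover have "U - X - (C - X) = U - C" using assms(3) by blast
  ultimately show ?thesis using card_odd_comps_split[of "U - X" "C - X"] assms(1) by simp
qed

lemma card_odd_comps_of_comp:
  "C \<in> comps E U \<Longrightarrow> card (odd_comps E C) = (if odd (card C) then 1 else 0)"
  by (auto simp: odd_comps_def comps_of_comp Collect_conv_if)

text \<open>Peeling off one component changes both counts by the same parity.\<close>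

lemma parity_odd_comps: "finite U \<Longrightarrow> even (card (odd_comps E U)) \<longleftrightarrow> even (card U)"
proof (induction U rule: finite_psubset_induct)
  case (psubset U)
  show ?case
  proof (cases "U = {}")
    case True
    then have "odd_comps E U = {}"
      using comps_subset[of _ E U] comps_nonempty[of _ E U] by (auto simp: odd_comps_def)
    then show ?thesis using True by simp
  next
    case False
    then obtain C where C: "C \<in> comps E U" using comp_exists by blast
    have sub: "C \<subseteq> U" "C \<noteq> {}" using C comps_subset comps_nonempty by blast+
    have "card U = card C + card (U - C)"
      using sub psubset.hyps by (metis card_Diff_subset card_mono finite_subset le_add_diff_inverse)
    moreover have "even (card (odd_comps E (U - C))) \<longleftrightarrow> even (card (U - C))"
      using sub by (intro psubset.IH) blast
    ultimately show ?thesis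
      using card_odd_comps_split[OF psubset.hyps comps_closed[OF C]] card_odd_comps_of_comp[OF C]
      by simp
  qed
qed

section \<open>Perfect matchings as involutions\<close>

lemma matchable_Union:
  assumes "\<And>A. A \<in> P \<Longrightarrow> matchable E A" "\<And>A B. A \<in> P \<Longrightarrow> B \<in> P \<Longrightarrow> A \<noteq> B \<Longrightarrow> A \<inter> B = {}"
  shows "matchable E (\<Union>P)"
proof -
  obtain f where f: "\<And>A x. A \<in> P \<Longrightarrow> x \<in> A \<Longrightarrow> f A x \<in> A \<and> E x (f A x) \<and> f A (f A x) = x"
    using assms(1) unfolding matchable_def by metis
  \<comment> \<open>By disjointness \<open>c x\<close> is the only block containing
    \<open>x\<close>; it selects the involution to apply at \<open>x\<close>.\<close>
  define c where "c x = (THE A. A \<in> P \<and> x \<in> A)" for x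
  have c: "c x = A" if "A \<in> P" "x \<in> A" for A x
    unfolding c_def using that assms(2)[of _ A] by (intro the_equality) blast+
  have "\<forall>x\<in>\<Union>P. f (c x) x \<in> \<Union>P \<and> E x (f (c x) x) \<and> f (c (f (c x) x)) (f (c x) x) = x"
  proof
    fix x assume "x \<in> \<Union>P"
    then obtain A where A: "A \<in> P" "x \<in> A" by blast
    then have "c (f A x) = A" using c f by blast
    then show "f (c x) x \<in> \<Union>P \<and> E x (f (c x) x) \<and> f (c (f (c x) x)) (f (c x) x) = x"
      using A f[OF A] c[OF A] by auto
  qed
  then show ?thesis unfolding matchable_def by (intro exI[of _ "\<lambda>x. f (c x) x"])
qed

lemma matchable_insert2:
  assumes "matchable E U" "E c s" "c \<noteq> s" "c \<notin> U" "s \<notin> U"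
  shows "matchable E (insert s (insert c U))"
proof -
  obtain f where f: "\<And>x. x \<in> U \<Longrightarrow> f x \<in> U \<and> E x (f x) \<and> f (f x) = x"
    using assms(1) unfolding matchable_def by blast
  have "E s c" using sym assms(2) by (rule sympD)
  define g where "g = f(c := s, s := c)"
  have g: "g c = s" "g s = c" using assms(3) by (simp_all add: g_def)
  have gU: "g x = f x" if "x \<in> U" for x using that assms(4,5) by (auto simp: g_def)
  have "g x \<in> insert s (insert c U) \<and> E x (g x) \<and> g (g x) = x" if "x \<in> insert s (insert c U)" for x
  proof (cases "x \<in> U")
    case True
    then show ?thesis using f[OF True] gU[of x] gU[of "f x"] by simp
  next
    case False
    then have "x = s \<or> x = c" using that by blast
    then show ?thesis using g assms(2) \<open>E s c\<close> by auto
  qed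
  then show ?thesis unfolding matchable_def by blast
qed

text \<open>Irreflexivity excludes fixed points of the involution, which would be loops.\<close>

lemma even_card_if_matchable:
  assumes "irreflp E" "finite U" "matchable E U"
  shows "even (card U)"
proof -
  obtain f where f: "\<And>x. x \<in> U \<Longrightarrow> f x \<in> U \<and> E x (f x) \<and> f (f x) = x"
    using assms(3) unfolding matchable_def by blast
  have "f x \<noteq> x" if "x \<in> U" for x
    using f[OF that] assms(1) by (auto dest: irreflpD)
  then show ?thesis
    using f assms(2) by (intro even_card_if_fixpoint_free_involution[of U f]) simp_all
qed

text \<open>This is the easy direction of Tutte's theorem: every odd component has a vertex matched
  into \<open>S\<close>, and different components use different partners.\<close>

lemma matchable_imp_card_odd_comps_le:
  assumes "irreflp E" "finite U" "matchable E U" "S \<subseteq> U"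
  shows "card (odd_comps E (U - S)) \<le> card S"
proof -
  obtain f where f: "\<And>x. x \<in> U \<Longrightarrow> f x \<in> U \<and> E x (f x) \<and> f (f x) = x"
    using assms(3) unfolding matchable_def by blast
  have "\<exists>x\<in>C. f x \<in> S" if C: "C \<in> odd_comps E (U - S)" for C
  proof (rule ccontr)
    \<comment> \<open>If no partner lies in \<open>S\<close>, then \<open>f\<close> maps
      \<open>C\<close> to itself and \<open>C\<close> is even.\<close>
    assume none: "\<not> (\<exists>x\<in>C. f x \<in> S)"
    have cl: "closed_in E (U - S) C" using C comps_closed by (auto simp: odd_comps_def)
    have CU: "C \<subseteq> U - S" using cl by (simp add: closed_in_def)
    have "f x \<in> C \<and> E x (f x) \<and> f (f x) = x" if "x \<in> C" for x
    proof -
      have "x \<in> U" using that CU by blast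
      moreover from f[OF this] have "f x \<in> C" using that cl none by (simp add: closed_in_def)
      ultimately show ?thesis using f[of x] by blast
    qed
    then have "matchable E C" unfolding matchable_def by blast
    moreover have "finite C" using CU assms(2) by (meson finite_Diff finite_subset)
    ultimately have "even (card C)" using even_card_if_matchable[OF assms(1)] by blast
    then show False using C by (simp add: odd_comps_def)
  qed
  then obtain g where g: "\<And>C. C \<in> odd_comps E (U - S) \<Longrightarrow> g C \<in> C \<and> f (g C) \<in> S" by metis
  have "inj_on (\<lambda>C. f (g C)) (odd_comps E (U - S))"
  proof (rule inj_onI)
    fix C D assume CD: "C \<in> odd_comps E (U - S)" "D \<in> odd_comps E (U - S)" "f (g C) = f (g D)"
    have "C \<subseteq> U" "D \<subseteq> U"
      using CD(1,2) comps_subset[of C E "U - S"] comps_subset[of D E "U - S"]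
      by (simp_all add: odd_comps_def subset_iff)
    then have "f (f (g C)) = g C" "f (f (g D)) = g D"
      using f[of "g C"] f[of "g D"] g[OF CD(1)] g[OF CD(2)] by auto
    then have "g C = g D" by (metis CD(3))
    then have "C \<inter> D \<noteq> {}" using g[OF CD(1)] g[OF CD(2)] by auto
    then show "C = D" using CD comps_disjoint[of C E "U - S" D] by (auto simp: odd_comps_def)
  qed
  moreover have "finite S" using assms finite_subset by blast
  moreover have "(\<lambda>C. f (g C)) ` odd_comps E (U - S) \<subseteq> S"
    using g by (intro image_subsetI) blast
  ultimately show ?thesis by (intro card_inj_on_le)
qed

end

text \<open>The singleton \<open>{x}\<close> is itself a component, and an odd one.\<close>

lemma card_odd_comps_isolated:
  assumes "symp E" "finite U" "x \<in> U" "\<And>y. y \<in> U \<Longrightarrow> \<not> E x y"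
  shows "card (odd_comps E U) = Suc (card (odd_comps E (U - {x})))"
proof -
  have "{x} \<in> comps E U" using assms(3,4) by (auto simp: comps_def closed_in_def)
  then show ?thesis
    using card_odd_comps_split[OF assms(1,2) comps_closed] card_odd_comps_of_comp[OF assms(1)]
    by fastforce
qed

section \<open>The theorems of Tutte and Petersen\<close>

theorem tutte:
 fixes E :: "'a \<Rightarrow> 'a \<Rightarrow> bool"
 assumes sym: "symp E" and  "finite U" "\<And>S. S \<subseteq> U \<Longrightarrow> card (odd_comps E (U - S)) \<le> card S"
  shows "matchable E U"
  using assms(2,3)
proof (induction U rule: finite_psubset_induct)
  case (psubset U)
  note tutte = psubset.prems and fin = psubset.hyps
  let ?tight = "\<lambda>S. S \<subseteq> U \<and> card (odd_comps E (U - S)) = card S"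
  \<comment> \<open>For the empty set Tutte's condition bounds the number of odd components by zero,
    so equality holds and a maximal tight set exists.\<close>
  have "?tight {}" using tutte[of "{}"] by simp
  then have "{S. ?tight S} \<noteq> {}" by blast
  moreover have "finite {S. ?tight S}" using fin by simp
  ultimately have "\<exists>S\<in>{S. ?tight S}. \<forall>T\<in>{S. ?tight S}. S \<subseteq> T \<longrightarrow> S = T"
    by (intro finite_has_maximal)
  then obtain S where S_in: "S \<in> {S. ?tight S}"
    and S_max: "\<forall>T\<in>{S. ?tight S}. S \<subseteq> T \<longrightarrow> S = T"
    by (rule bexE)
  have S: "?tight S" using S_in by simp
  have max: "T = S" if "?tight T" "S \<subseteq> T" for T
    using bspec[OF S_max, of T] that by simp
  have SU: "S \<subseteq> U" and qS: "card (odd_comps E (U - S)) = card S" using S by simp_all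
  have finS: "finite S" using SU fin by (rule finite_subset)
  \<comment> \<open>Maximality of \<open>S\<close> makes Tutte's inequality strict for every larger
    set.\<close>
  have not_tight: "card (odd_comps E (U - S - X)) < card S + card X"
    if X: "X \<subseteq> U - S" "X \<noteq> {}" for X
  proof -
    have sub: "S \<union> X \<subseteq> U" using X SU by blast
    have finX: "finite X" using X(1) fin by (meson finite_Diff finite_subset)
    have "card (S \<union> X) = card S + card X"
      using X(1) finS finX by (intro card_Un_disjoint) auto
    moreover have "U - (S \<union> X) = U - S - X" by blast
    moreover have "S \<union> X \<noteq> S" using X by blast
    then have "\<not> ?tight (S \<union> X)" using max[of "S \<union> X"] by blast
    ultimately show ?thesis using tutte[OF sub] sub by simp
  qed
  have split: "card (odd_comps E (U - S)) = (if odd (card C) then 1 else 0) + card (odd_comps E (U - S - C))"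
    if "C \<in> comps E (U - S)" for C
    using card_odd_comps_split[OF sym _ comps_closed[OF that]] card_odd_comps_of_comp[OF sym that] fin by simp
  \<comment> \<open>An even component minus a vertex has odd order and so contains an odd component.
    Hence deleting \<open>v\<close> would raise the number of odd components to at least
    \<open>card S + 1\<close>, against strictness.\<close>
  have odd: "odd (card C)" if C: "C \<in> comps E (U - S)" for C
  proof (rule ccontr)
    assume even: "\<not> odd (card C)"
    obtain v where v: "v \<in> C" using comps_nonempty[OF C] by blast
    have sub: "C \<subseteq> U - S" using comps_subset[OF C] .
    then have finC: "finite C" using fin by (meson finite_Diff finite_subset)
    have "odd (card (C - {v}))" using even v finC by (metis card_Suc_Diff1 even_Suc)
    then have "card (odd_comps E (C - {v})) \<noteq> 0" using parity_odd_comps[OF sym, of "C - {v}"] finC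
      by (metis even_zero finite_Diff)
    moreover have "card (odd_comps E (U - S - {v})) =
        card (odd_comps E (C - {v})) + card (odd_comps E (U - S - C))"
      using fin v by (intro card_odd_comps_Diff[OF sym _ C]) auto
    moreover have "card (odd_comps E (U - S - {v})) < card S + card {v}"
      using v sub by (intro not_tight) auto
    ultimately show False using split[OF C] even qS by simp
  qed
  have critical: "matchable E (C - {v})" if C: "C \<in> comps E (U - S)" and v: "v \<in> C" for C v
  proof (rule psubset.IH)
    have sub: "C \<subseteq> U - S" using comps_subset[OF C] .
    then have finC: "finite C" using fin by (meson finite_Diff finite_subset)
    show "C - {v} \<subset> U" using sub v by blast
    show "card (odd_comps E (C - {v} - T)) \<le> card T" if T: "T \<subseteq> C - {v}" for T
    proof -
      have finT: "finite T" using T finC by (meson finite_Diff finite_subset)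
      have vT: "v \<notin> T" "insert v T \<subseteq> C" using T v by blast+
      have eq: "C - insert v T = C - {v} - T" by blast
      have "card (odd_comps E (U - S - insert v T)) =
          card (odd_comps E (C - {v} - T)) + card (odd_comps E (U - S - C))"
        using fin vT card_odd_comps_Diff[OF sym _ C, of "insert v T"] by (simp add: eq)
      moreover have "card (odd_comps E (U - S - insert v T)) < card S + card (insert v T)"
        using vT sub by (intro not_tight) auto
      \<comment> \<open>The odd component \<open>C\<close> accounts for one of the
        \<open>card S\<close> odd components, and \<open>v\<close> adds one to the deleted set. The
        remaining case of \<open>card T + 1\<close> odd components is excluded by parity, as
        \<open>C - {v}\<close> has even order.\<close>
      ultimately have "card (odd_comps E (C - {v} - T)) < card T + 2"
        using split[OF C] odd[OF C] qS vT finT by simp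
      moreover have "card C = Suc (card T + card (C - {v} - T))"
        using vT finC finT card_Diff_subset[of "insert v T" C] card_mono[of C "insert v T"]
        by (simp add: eq)
      then have "even (card (odd_comps E (C - {v} - T))) \<longleftrightarrow> even (card T)"
        using odd[OF C] parity_odd_comps[OF sym, of "C - {v} - T"] finC by simp
      ultimately show ?thesis by (cases "card (odd_comps E (C - {v} - T)) = Suc (card T)") simp_all
    qed
  qed
  let ?I = "comps E (U - S)"
  let ?A = "\<lambda>C. {s \<in> S. \<exists>c\<in>C. E c s}"
  have "\<exists>R. (\<forall>C\<in>?I. R C \<in> ?A C) \<and> inj_on R ?I"
  proof (rule hall)
    show "finite ?I" using fin by (simp add: finite_comps)
    show "finite (?A C)" for C using finS by simp
    show "card J \<le> card (\<Union>(?A ` J))" if J: "J \<subseteq> ?I" for J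
    proof -
      let ?N = "\<Union>(?A ` J)"
      \<comment> \<open>No member of \<open>J\<close> has a neighbour in \<open>S - ?N\<close>, so
        restoring these vertices keeps it a component. Tutte's condition for \<open>?N\<close> is
        then Hall's condition for \<open>J\<close>.\<close>
      have "J \<subseteq> odd_comps E (U - ?N)"
      proof
        fix C assume CJ: "C \<in> J"
        then have C: "C \<in> ?I" using J by blast
        have NS: "?N \<subseteq> S" by blast
        have CUS: "C \<subseteq> U - S" using comps_subset[OF C] .
        have clC: "closed_in E (U - ?N) C"
          unfolding closed_in_def
        proof (intro conjI ballI impI)
          show "C \<subseteq> U - ?N" using CUS NS by blast
          fix x y assume xy: "x \<in> C" "y \<in> U - ?N" "E x y"
          then have "y \<notin> S" using CJ by blast
          then show "y \<in> C" using xy comps_closed[OF C] unfolding closed_in_def by blast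
        qed
        have "D = C" if D: "closed_in E (U - ?N) D" "D \<noteq> {}" "D \<subseteq> C" for D
        proof (rule comps_minimal[OF C _ D(2,3)])
          have "D \<subseteq> U - S" using D(3) CUS by (rule subset_trans)
          moreover have "U - S \<subseteq> U - ?N" using NS by blast
          ultimately show "closed_in E (U - S) D" using D(1) unfolding closed_in_def by (meson subsetD)
        qed
        then have "C \<in> comps E (U - ?N)"
          using clC comps_nonempty[OF C] unfolding comps_def by blast
        then show "C \<in> odd_comps E (U - ?N)" using odd[OF C] by (simp add: odd_comps_def)
      qed
      then have "card J \<le> card (odd_comps E (U - ?N))"
        using fin by (intro card_mono finite_odd_comps) auto
      also have "\<dots> \<le> card ?N" using SU by (intro tutte) blast
      finally show ?thesis .
    qed
  qed
  then obtain R where R: "\<And>C. C \<in> ?I \<Longrightarrow> R C \<in> ?A C" and inj: "inj_on R ?I" by blast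
  have "odd_comps E (U - S) = ?I" using odd by (auto simp: odd_comps_def)
  then have "card (R ` ?I) = card S" using qS inj by (simp add: card_image)
  \<comment> \<open>There are exactly \<open>card S\<close> components, so the injective choice
    \<open>R\<close> uses up all of \<open>S\<close>.\<close>
  then have surj: "R ` ?I = S" using R finS by (intro card_subset_eq) auto
  have "matchable E (\<Union>((\<lambda>C. insert (R C) C) ` ?I))"
  proof (rule matchable_Union[OF sym])
    fix A assume "A \<in> (\<lambda>C. insert (R C) C) ` ?I"
    then obtain C where C: "C \<in> ?I" "A = insert (R C) C" by blast
    obtain c where c: "c \<in> C" "E c (R C)" using R[OF C(1)] by blast
    have "R C \<notin> C" using R[OF C(1)] comps_subset[OF C(1)] by blast
    \<comment> \<open>The vertex \<open>c\<close> is matched with \<open>R C\<close>, and the rest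
      of \<open>C\<close> within itself.\<close>
    then have "matchable E (insert (R C) (insert c (C - {c})))"
      using c critical[OF C(1) c(1)] by (intro matchable_insert2[OF sym]) auto
    then show "matchable E A" using C c by (simp add: insert_absorb)
  next
    fix A B assume "A \<in> (\<lambda>C. insert (R C) C) ` ?I" "B \<in> (\<lambda>C. insert (R C) C) ` ?I" "A \<noteq> B"
    then obtain C D where CD: "C \<in> ?I" "D \<in> ?I" "C \<noteq> D" "A = insert (R C) C" "B = insert (R D) D"
      by blast
    then have "R C \<noteq> R D" using inj by (auto dest: inj_onD)
    moreover have "R C \<in> S" "R D \<in> S" using R[OF CD(1)] R[OF CD(2)] by simp_all
    moreover have "R C \<notin> D" "R D \<notin> C"
      using calculation comps_subset[OF CD(1)] comps_subset[OF CD(2)] by blast+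
    ultimately show "A \<inter> B = {}" using CD(4,5) comps_disjoint[OF CD(1-3)] by simp
  qed
  moreover have "\<Union>((\<lambda>C. insert (R C) C) ` ?I) = R ` ?I \<union> \<Union>?I" by auto
  moreover have "R ` ?I \<union> \<Union>?I = U" using surj SU Union_comps[OF sym, of "U - S"] by auto
  ultimately show ?case by simp
qed

section \<open>Petersen's theorem by counting edges\<close>

text \<open>Each edge inside \<open>C\<close> is counted once in each direction.\<close>

lemma even_card_adjacent_pairs:
  assumes "symp E" "irreflp E" "finite C"
  shows "even (card (SIGMA x:C. {y \<in> C. E x y}))"
proof (rule even_card_if_fixpoint_free_involution[where f = prod.swap])
  fix p assume p: "p \<in> (SIGMA x:C. {y \<in> C. E x y})"
  then obtain x y where xy: "p = (x, y)" "x \<in> C" "y \<in> C" "E x y" by blast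
  then show "prod.swap p \<in> (SIGMA x:C. {y \<in> C. E x y})" using sympD[OF assms(1) xy(4)] by simp
  show "prod.swap p \<noteq> p" using xy irreflpD[OF assms(2), of x] by auto
qed (use assms(3) in auto)

text \<open>
  By parity an odd component \<open>C\<close> of \<open>V - S\<close> sends an odd number of edges to \<open>S\<close>. It cannot be
  one, since the end of a single such edge in \<open>C\<close> would be a cut vertex.
\<close>

lemma odd_comp_edges_ge_3:
  assumes "symp E" "irreflp E" "finite V"
    and deg: "\<And>x. x \<in> V \<Longrightarrow> card {y \<in> V. E x y} = 3"
    and no_cut: "\<And>v W. v \<in> V \<Longrightarrow> closed_in E (V - {v}) W \<Longrightarrow> W \<noteq> {} \<Longrightarrow> W = V - {v}"
    and "S \<subseteq> V" "C \<in> odd_comps E (V - S)"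
  shows "3 \<le> card (SIGMA x:C. {y \<in> S. E x y})"
proof -
  define d where "d = (SIGMA x:C. {y \<in> S. E x y})"
  define i where "i = (SIGMA x:C. {y \<in> C. E x y})"
  have cl: "closed_in E (V - S) C" and oddC: "odd (card C)"
    using assms(7) comps_closed by (auto simp: odd_comps_def)
  have CV: "C \<subseteq> V - S" using cl by (simp add: closed_in_def)
  have fin: "finite C" "finite S" using CV assms(3,6) by (meson finite_Diff finite_subset)+
  \<comment> \<open>Edges from \<open>C\<close> end in \<open>C\<close> or in \<open>S\<close>, so
    the degree sum of \<open>C\<close> splits into \<open>i\<close> and \<open>d\<close>.\<close>
  have "(SIGMA x:C. {y \<in> V. E x y}) = i \<union> d"
    using cl assms(6) unfolding closed_in_def d_def i_def by blast
  moreover have "i \<inter> d = {}" using CV unfolding d_def i_def by blast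
  moreover have "card (SIGMA x:C. {y \<in> V. E x y}) = (\<Sum>x\<in>C. 3)"
  proof (subst card_SigmaI)
    show "(\<Sum>x\<in>C. card {y \<in> V. E x y}) = (\<Sum>x\<in>C. 3)"
      using CV deg by (intro sum.cong) blast+
  qed (use fin assms(3) in auto)
  moreover have "finite i" "finite d" using fin by (simp_all add: d_def i_def)
  ultimately have sum: "card C * 3 = card i + card d"
    by (simp add: card_Un_disjoint)
  moreover have "even (card i)"
    unfolding i_def by (rule even_card_adjacent_pairs[OF assms(1,2) fin(1)])
  moreover have "odd (card C * 3)" using oddC by simp
  ultimately have "odd (card d)" by simp
  moreover have "card d \<noteq> 1"
  proof
    assume one: "card d = 1"
    then obtain p where p: "d = {p}" by (rule card_1_singletonE)
    obtain a b where ab: "p = (a, b)" by (cases p)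
    have "(a, b) \<in> d" using p ab by simp
    then have a: "a \<in> C" and b: "b \<in> S" by (auto simp: d_def)
    have only: "x = a" if "x \<in> C" "y \<in> S" "E x y" for x y
    proof -
      have "(x, y) \<in> d" using that by (simp add: d_def)
      then show ?thesis using p ab by simp
    qed
    show False
    proof (cases "C = {a}")
      case True
      \<comment> \<open>A single vertex has no inner edges, so \<open>d\<close> would have three
        elements.\<close>
      then have "i = {}" using irreflpD[OF assms(2)] by (auto simp: i_def)
      then show False using sum one True by simp
    next
      case False
      \<comment> \<open>The only edge from \<open>C\<close> to \<open>S\<close> starts at
        \<open>a\<close>. Hence \<open>C - {a}\<close> is closed once \<open>a\<close> is gone, yet
        it misses \<open>b\<close>, which contradicts \<open>no_cut\<close>.\<close>
      have "closed_in E (V - {a}) (C - {a})"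
        unfolding closed_in_def
      proof (intro conjI ballI impI)
        show "C - {a} \<subseteq> V - {a}" using CV by blast
        fix x y assume xy: "x \<in> C - {a}" "y \<in> V - {a}" "E x y"
        then have "y \<notin> S" using only[of x y] by blast
        then show "y \<in> C - {a}" using xy cl unfolding closed_in_def by blast
      qed
      moreover have "C - {a} \<noteq> {}" using False a by blast
      moreover have "a \<in> V" using a CV by blast
      ultimately have "C - {a} = V - {a}" using no_cut by blast
      then show False using a b CV assms(6) by blast
    qed
  qed
  ultimately have "3 \<le> card d" by presburger
  then show ?thesis by (simp only: d_def)
qed

text \<open>Tutte's condition follows by double counting: each odd component sends at least three
  edges to \<open>S\<close>, and each vertex of \<open>S\<close> receives at most three.\<close>

theorem petersen:
  assumes "symp E" "irreflp E" "finite V"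
    and deg: "\<And>x. x \<in> V \<Longrightarrow> card {y \<in> V. E x y} = 3"
    and no_cut: "\<And>v W. v \<in> V \<Longrightarrow> closed_in E (V - {v}) W \<Longrightarrow> W \<noteq> {} \<Longrightarrow> W = V - {v}"
  shows "matchable E V"
proof (rule tutte[OF assms(1,3)])
  fix S assume S: "S \<subseteq> V"
  let ?O = "odd_comps E (V - S)" and ?d = "\<lambda>C. SIGMA x:C. {y \<in> S. E x y}"
  \<comment> \<open>These are the same edges seen from \<open>S\<close>, together with all others
    starting in \<open>S\<close>; this gives the upper bound.\<close>
  let ?Q = "SIGMA y:S. {x \<in> V. E y x}"
  have finS: "finite S" using S assms(3) by (rule finite_subset)
  have finO: "finite ?O" using assms(3) by (intro finite_odd_comps finite_Diff)
  have sub: "C \<subseteq> V - S" if "C \<in> ?O" for C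
    using that comps_subset[of C E "V - S"] by (simp add: odd_comps_def)
  have "card ?O * 3 \<le> (\<Sum>C\<in>?O. card (?d C))"
  proof -
    have "of_nat (card ?O) * 3 \<le> (\<Sum>C\<in>?O. card (?d C))"
      by (intro sum_bounded_below odd_comp_edges_ge_3[OF assms S])
    then show ?thesis by (simp only: of_nat_id)
  qed
  also have "\<dots> = card (\<Union>C\<in>?O. ?d C)"
  proof (rule card_UN_disjoint[symmetric])
    show "\<forall>C\<in>?O. finite (?d C)"
    proof
      fix C assume "C \<in> ?O"
      then have "finite C" using sub assms(3) by (meson finite_Diff finite_subset)
      then show "finite (?d C)" using finS by simp
    qed
    show "\<forall>C\<in>?O. \<forall>D\<in>?O. C \<noteq> D \<longrightarrow> ?d C \<inter> ?d D = {}"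
    proof (intro ballI impI)
      fix C D assume "C \<in> ?O" "D \<in> ?O" "C \<noteq> D"
      then have "C \<inter> D = {}" using comps_disjoint[of C E "V - S" D] by (simp add: odd_comps_def)
      then show "?d C \<inter> ?d D = {}" by blast
    qed
  qed (rule finO)
  also have "\<dots> \<le> card (prod.swap ` ?Q)"
  proof (rule card_mono)
    show "finite (prod.swap ` ?Q)" using finS assms(3) by simp
    show "(\<Union>C\<in>?O. ?d C) \<subseteq> prod.swap ` ?Q"
    proof
      fix p assume "p \<in> (\<Union>C\<in>?O. ?d C)"
      then obtain C x y where "C \<in> ?O" "p = (x, y)" "x \<in> C" "y \<in> S" "E x y" by blast
      moreover from this have "E y x" using assms(1) by (auto dest: sympD)
      ultimately show "p \<in> prod.swap ` ?Q" using sub by (intro image_eqI[of _ _ "(y, x)"]) auto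
    qed
  qed
  also have "\<dots> = card ?Q" by (intro card_image) simp
  also have "\<dots> = (\<Sum>y\<in>S. 3)"
  proof (subst card_SigmaI)
    show "(\<Sum>y\<in>S. card {x \<in> V. E y x}) = (\<Sum>y\<in>S. 3)"
      using S deg by (intro sum.cong) blast+
  qed (use finS assms(3) in auto)
  finally show "card ?O \<le> card S" by simp
qed

section \<open>Transfer to digraphs\<close>

text \<open>Deleting vertices from a digraph alters its adjacency outside the remaining set only, so
  \<open>dominates G\<close> can be kept throughout.\<close>

lemma closed_in_cong:
  assumes "\<And>x y. x \<in> U \<Longrightarrow> y \<in> U \<Longrightarrow> E x y = E' x y"
  shows "closed_in E U = closed_in E' U"
  using assms unfolding closed_in_def fun_eq_iff by (metis subsetD)

lemma odd_comps_cong: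
  assumes "\<And>x y. x \<in> U \<Longrightarrow> y \<in> U \<Longrightarrow> E x y = E' x y"
  shows "odd_comps E U = odd_comps E' U"
proof -
  have "closed_in E U = closed_in E' U" using assms by (rule closed_in_cong)
  then show ?thesis by (simp add: odd_comps_def comps_def)
qed

lemma matchable_cong:
  assumes "\<And>x y. x \<in> U \<Longrightarrow> y \<in> U \<Longrightarrow> E x y = E' x y"
  shows "matchable E U = matchable E' U"
  using assms unfolding matchable_def by metis

lemma verts_delete_verts [simp]: "verts (delete_verts G S) = verts G - S"
  by (simp add: delete_verts_def)

lemma dominates_delete_verts:
  "u \<rightarrow>\<^bsub>delete_verts G S\<^esub> v \<longleftrightarrow> u \<rightarrow>\<^bsub>G\<^esub> v \<and> u \<in> verts G - S \<and> v \<in> verts G - S"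
  by (auto simp: delete_verts_def arcs_ends_conv)

lemma graph_delete_verts:
  assumes "graph G"
  shows "graph (delete_verts G S)"
proof -
  interpret graph G by fact
  let ?H = "delete_verts G S"
  have ind: "induced_subgraph ?H G" unfolding delete_verts_def by (rule induced_induce) blast
  interpret H: sym_digraph ?H using ind by (rule induced_graph_imp_graph)
  show ?thesis
  proof unfold_locales
    show "finite (verts ?H)" "finite (arcs ?H)" by (simp_all add: delete_verts_def)
    fix e assume "e \<in> arcs ?H"
    then show "tail ?H e \<noteq> head ?H e" using no_loops by (simp add: delete_verts_def)
  next
    fix e1 e2 assume "e1 \<in> arcs ?H" "e2 \<in> arcs ?H" "arc_to_ends ?H e1 = arc_to_ends ?H e2"
    then show "e1 = e2" using no_multi_arcs by (simp add: delete_verts_def)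
  qed
qed

section \<open>Components, connectivity and matchings of a digraph\<close>

context graph
begin

lemma symp_dominates: "symp (dominates G)"
  using sym_arcs by (auto simp: symmetric_def sym_def symp_def)

lemma irreflp_dominates: "irreflp (dominates G)"
  using adj_not_same by (auto intro: irreflpI)

lemma reachable_closed_in:
  assumes "u \<rightarrow>\<^sup>* v" "u \<in> W" "closed_in (dominates G) (verts G) W"
  shows "v \<in> W"
  using assms(1)
proof (induction rule: reachable_induct)
  case (step x y)
  then show ?case using assms(3) adj_in_verts unfolding closed_in_def by blast
qed (rule assms(2))

text \<open>A symmetric connected digraph is strongly connected, so one vertex of \<open>W\<close>
  reaches all others without leaving \<open>W\<close>.\<close>

lemma connected_closed_in:
  assumes "Digraph_Component.connected G" "closed_in (dominates G) (verts G) W" "W \<noteq> {}"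
  shows "W = verts G"
proof -
  have "strongly_connected G"
    using sym_arcs assms(1) by (rule symmetric_connected_imp_strongly_connected)
  moreover obtain w where w: "w \<in> W" using assms(3) by blast
  moreover have sub: "W \<subseteq> verts G" using assms(2) by (simp add: closed_in_def)
  ultimately have "w \<rightarrow>\<^sup>* v" if "v \<in> verts G" for v
    using that unfolding strongly_connected_def by blast
  then show ?thesis using reachable_closed_in[OF _ w assms(2)] sub by blast
qed

lemma sccs_verts_eq_comps: "sccs_verts = comps (dominates G) (verts G)"
proof (intro equalityI subsetI)
  fix S assume S: "S \<in> sccs_verts"
  have reach: "u \<rightarrow>\<^sup>* v" if "u \<in> S" "v \<in> S" for u v
    using S that by (simp add: in_sccs_verts_conv_reachable)
  have ne: "S \<noteq> {}" using S by (simp add: in_sccs_verts_conv_reachable)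
  have sub: "S \<subseteq> verts G" using S by (rule sccs_verts_subsets)
  have "closed_in (dominates G) (verts G) S"
    unfolding closed_in_def
  proof (intro conjI ballI impI)
    fix x y assume xy: "x \<in> S" "x \<rightarrow> y"
    \<comment> \<open>Reachability is symmetric, so an edge cannot leave a strong component.\<close>
    then have "x \<rightarrow>\<^sup>* y" by blast
    moreover from this have "y \<rightarrow>\<^sup>* x" by (rule symmetric_reachable')
    ultimately show "y \<in> S" using S xy(1) unfolding in_sccs_verts_conv_reachable by blast
  qed (rule sub)
  moreover have "D = S" if D: "closed_in (dominates G) (verts G) D" "D \<noteq> {}" "D \<subseteq> S" for D
  proof -
    obtain d where d: "d \<in> D" using D(2) by blast
    have "s \<in> D" if "s \<in> S" for s
      using reach[of d s] d D(3) that by (intro reachable_closed_in[OF _ d D(1)]) blast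
    then show ?thesis using D(3) by blast
  qed
  ultimately show "S \<in> comps (dominates G) (verts G)" using ne by (simp add: comps_def)
next
  fix C assume C: "C \<in> comps (dominates G) (verts G)"
  \<comment> \<open>The set reachable from \<open>x\<close> is closed and lies in \<open>C\<close>,
    hence equals \<open>C\<close> by minimality.\<close>
  have reach_iff: "x \<rightarrow>\<^sup>* y \<longleftrightarrow> y \<in> C" if x: "x \<in> C" for x y
  proof -
    have xV: "x \<in> verts G" using x comps_subset[OF C] by blast
    have sub: "{y. x \<rightarrow>\<^sup>* y} \<subseteq> C" using reachable_closed_in[OF _ x comps_closed[OF C]] by blast
    have "closed_in (dominates G) (verts G) {y. x \<rightarrow>\<^sup>* y}"
      unfolding closed_in_def by (auto intro: reachable_adj_trans dest: reachable_in_verts)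
    then have "{y. x \<rightarrow>\<^sup>* y} = C" using xV sub by (intro comps_minimal[OF C]) auto
    then show ?thesis by blast
  qed
  then show "C \<in> sccs_verts"
    using comps_nonempty[OF C] by (simp add: in_sccs_verts_conv_reachable)
qed

text \<open>Strong components are subgraphs, but each is determined by its vertex set, so both
  counts agree.\<close>

lemma card_odd_components: "card (odd_components G) = card (odd_comps (dominates G) (verts G))"
proof -
  have "odd_comps (dominates G) (verts G) = verts ` odd_components G"
    by (auto simp: odd_comps_def odd_components_def sccs_verts_conv simp flip: sccs_verts_eq_comps)
  moreover have "inj_on verts (odd_components G)"
    using inj_on_verts_sccs by (rule inj_on_subset) (auto simp: odd_components_def)
  ultimately show ?thesis by (simp add: card_image)
qed

lemma has_perfect_matching_iff: "has_perfect_matching G \<longleftrightarrow> matchable (dominates G) (verts G)"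
proof
  assume "has_perfect_matching G"
  then obtain M where M: "M \<subseteq> edges G" "\<forall>v \<in> verts G. \<exists>!e. e \<in> M \<and> v \<in> e"
    unfolding has_perfect_matching_def perfect_matching_def by (elim exE conjE)
  have "\<exists>w. v \<rightarrow> w \<and> {v, w} \<in> M" if v: "v \<in> verts G" for v
  proof -
    obtain e where e: "e \<in> M" "v \<in> e" using bspec[OF M(2) v] by blast
    then obtain a b where "e = {a, b}" "a \<rightarrow> b" using M(1) unfolding edges_def by blast
    moreover from this have "b \<rightarrow> a" using symp_dominates by (auto dest: sympD)
    ultimately show ?thesis using e by (auto simp: insert_commute)
  qed
  then obtain f where f: "\<And>v. v \<in> verts G \<Longrightarrow> v \<rightarrow> f v \<and> {v, f v} \<in> M" by metis
  have "f v \<in> verts G \<and> v \<rightarrow> f v \<and> f (f v) = v" if v: "v \<in> verts G" for v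
  proof -
    have fv: "f v \<in> verts G" using f[OF v] adj_in_verts by blast
    \<comment> \<open>Both \<open>{v, f v}\<close> and \<open>{f v, f (f v)}\<close> are matching
      edges at \<open>f v\<close>; uniqueness makes \<open>f\<close> an involution.\<close>
    have "\<exists>!e. e \<in> M \<and> f v \<in> e" using M(2) fv by (rule bspec)
    then have "{v, f v} = {f v, f (f v)}" using f[OF v] f[OF fv] by blast
    then show ?thesis using f[OF v] fv by (auto simp: doubleton_eq_iff)
  qed
  then show "matchable (dominates G) (verts G)" unfolding matchable_def by blast
next
  assume "matchable (dominates G) (verts G)"
  then obtain f where f: "\<And>v. v \<in> verts G \<Longrightarrow> f v \<in> verts G \<and> v \<rightarrow> f v \<and> f (f v) = v"
    unfolding matchable_def by blast
  let ?M = "(\<lambda>v. {v, f v}) ` verts G"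
  have "\<exists>!e. e \<in> ?M \<and> v \<in> e" if v: "v \<in> verts G" for v
  proof (rule ex1I)
    show "{v, f v} \<in> ?M \<and> v \<in> {v, f v}" using v by simp
    fix e assume "e \<in> ?M \<and> v \<in> e"
    then obtain w where w: "w \<in> verts G" "e = {w, f w}" "v = w \<or> v = f w" by blast
    then show "e = {v, f v}" using f[OF w(1)] by (auto simp: insert_commute)
  qed
  moreover have "?M \<subseteq> edges G" using f unfolding edges_def by blast
  ultimately show "has_perfect_matching G"
    unfolding has_perfect_matching_def perfect_matching_def by blast
qed

text \<open>Without parallel arcs, an arc leaving \<open>v\<close> is determined by its
  head.\<close>

lemma out_degree_eq_card_dominates: "out_degree G v = card {w \<in> verts G. v \<rightarrow>\<^bsub>G\<^esub> w}"
proof -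
  have "{w \<in> verts G. v \<rightarrow>\<^bsub>G\<^esub> w} = head G ` out_arcs G v"
    by (auto simp: arcs_ends_conv out_arcs_def)
  moreover have "inj_on (head G) (out_arcs G v)"
    by (intro inj_onI no_multi_arcs) (auto simp: out_arcs_def arc_to_ends_def)
  ultimately show ?thesis by (simp add: out_degree_def card_image)
qed

lemma card_odd_components_delete_verts:
  "card (odd_components (delete_verts G S)) = card (odd_comps (dominates G) (verts G - S))"
proof -
  interpret H: graph "delete_verts G S" by (rule graph_delete_verts) unfold_locales
  have "odd_comps (dominates (delete_verts G S)) (verts G - S) = odd_comps (dominates G) (verts G - S)"
    by (rule odd_comps_cong) (simp add: dominates_delete_verts)
  then show ?thesis using H.card_odd_components by simp
qed

lemma has_perfect_matching_delete_verts:
  "has_perfect_matching (delete_verts G S) \<longleftrightarrow> matchable (dominates G) (verts G - S)"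
proof -
  interpret H: graph "delete_verts G S" by (rule graph_delete_verts) unfold_locales
  have "matchable (dominates (delete_verts G S)) (verts G - S) = matchable (dominates G) (verts G - S)"
    by (rule matchable_cong) (simp add: dominates_delete_verts)
  then show ?thesis using H.has_perfect_matching_iff by simp
qed

text \<open>This brings 2-connectedness into the form of the last hypothesis of
  \<open>petersen\<close>.\<close>

lemma no_cut_vertex:
  assumes "k_connected 2 G" "v \<in> verts G"
    and "closed_in (dominates G) (verts G - {v}) W" "W \<noteq> {}"
  shows "W = verts G - {v}"
proof -
  interpret H: graph "delete_verts G {v}" by (rule graph_delete_verts) unfold_locales
  have "closed_in (dominates (delete_verts G {v})) (verts G - {v}) = closed_in (dominates G) (verts G - {v})"
    by (rule closed_in_cong) (simp add: dominates_delete_verts)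
  then have "closed_in (dominates (delete_verts G {v})) (verts G - {v}) W" using assms(3) by simp
  moreover have "Digraph_Component.connected (delete_verts G {v})"
    using assms(1,2) by (simp add: k_connected_def)
  ultimately show ?thesis using H.connected_closed_in[of W] assms(4) by simp
qed

lemma perfect_matching_cubic:
  assumes "k_connected 2 G" "cubic G"
  shows "has_perfect_matching G"
  unfolding has_perfect_matching_iff
proof (rule petersen[OF symp_dominates irreflp_dominates])
  show "finite (verts G)" by simp
  show "card {y \<in> verts G. x \<rightarrow>\<^bsub>G\<^esub> y} = 3" if "x \<in> verts G" for x
    using assms(2) that by (simp add: cubic_def out_degree_eq_card_dominates)
qed (rule no_cut_vertex[OF assms(1)])

end

section \<open>Nice vertices and barriers\<close>

theorem theorem2p3:
  fixes G :: "('a,'b) pre_digraph" and u :: 'a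
  assumes "graph G" and "k_connected 2 G" and "cubic G" and "u \<in> verts G"
  shows "\<not> nice G u \<longleftrightarrow> (\<exists>S. barrier G S \<and> isolated_vertex (delete_verts G S) u)"
proof -
  interpret graph G by fact
  let ?E = "dominates G" and ?V = "verts G"
  define N where "N = neighbours G u"
  define U where "U = ?V - insert u N"
  note sym = symp_dominates and irrefl = irreflp_dominates
  have N: "N = {v \<in> ?V. u \<rightarrow>\<^bsub>G\<^esub> v}" unfolding N_def neighbours_def using adj_in_verts by blast
  have uN: "u \<notin> N" using N adj_not_same by blast
  have cardN: "card N = 3"
    using assms(3,4) by (simp add: N cubic_def out_degree_eq_card_dominates)
  have NV: "N \<subseteq> ?V" using N by blast
  have finN: "finite N" using NV by (rule finite_subset) simp
  have pmG: "has_perfect_matching G" using assms(2,3) by (rule perfect_matching_cubic)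
  then have matchV: "matchable ?E ?V" by (simp add: has_perfect_matching_iff)
  have nice: "nice G u \<longleftrightarrow> matchable ?E U"
    unfolding nice_def closed_neighbours_def has_perfect_matching_delete_verts U_def N_def ..
  have count: "card (odd_comps ?E (?V - S)) = Suc (card (odd_comps ?E (?V - S - {u})))"
    if "N \<subseteq> S" "u \<notin> S" for S
  proof (rule card_odd_comps_isolated[OF sym])
    show "u \<in> ?V - S" using assms(4) that by blast
    show "\<not> u \<rightarrow>\<^bsub>G\<^esub> y" if "y \<in> ?V - S" for y using that \<open>N \<subseteq> S\<close> N by blast
  qed simp
  show ?thesis
  proof
    assume "\<not> nice G u"
    then have "\<not> (\<forall>T\<subseteq>U. card (odd_comps ?E (U - T)) \<le> card T)"
      using tutte[OF sym, of U] nice by (auto simp: U_def)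
    then obtain T where T: "T \<subseteq> U" and more: "card T < card (odd_comps ?E (U - T))"
      by (auto simp: not_le)
    define S where "S = T \<union> N"
    have finT: "finite T" using T by (rule finite_subset) (simp add: U_def)
    have TN: "T \<inter> N = {}" using T by (auto simp: U_def)
    have cardS: "card S = card T + 3" using finT finN TN cardN by (simp add: S_def card_Un_disjoint)
    have SV: "S \<subseteq> ?V" using T NV by (auto simp: S_def U_def)
    have S: "N \<subseteq> S" "u \<notin> S" using T uN by (auto simp: S_def U_def)
    have UT: "?V - S - {u} = U - T" by (auto simp: S_def U_def)
    have finS: "finite S" using SV by (rule finite_subset) simp
    have uSV: "insert u S \<subseteq> ?V" using SV assms(4) by simp
    have "?V - insert u S = U - T" by (auto simp: S_def U_def)
    then have "card (U - T) = card ?V - card (insert u S)"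
      using card_Diff_subset[OF _ uSV] finS by simp
    moreover have "card (insert u S) \<le> card ?V" using uSV by (intro card_mono) simp_all
    \<comment> \<open>As \<open>insert u S\<close> has \<open>card T + 4\<close> elements and
      \<open>?V\<close> is even, \<open>U - T\<close> and \<open>T\<close> have the same
      parity.\<close>
    ultimately have "card ?V = card (U - T) + card (insert u S)" by simp
    moreover have "card (insert u S) = card T + 4" using S finS cardS by simp
    moreover have "even (card ?V)" using even_card_if_matchable[OF sym irrefl _ matchV] by simp
    ultimately have "even (card (U - T)) \<longleftrightarrow> even (card T)" by simp
    then have "even (card (odd_comps ?E (U - T))) \<longleftrightarrow> even (card T)"
      using parity_odd_comps[OF sym, of "U - T"] by (simp add: U_def)
    then have "card T + 2 \<le> card (odd_comps ?E (U - T))"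
      using more by (cases "card (odd_comps ?E (U - T)) = Suc (card T)") auto
    \<comment> \<open>The isolated vertex \<open>u\<close> raises \<open>card T + 2\<close> to
      \<open>card T + 3\<close>, which is \<open>card S\<close>.\<close>
    then have "card S \<le> card (odd_comps ?E (?V - S))" using count[OF S] UT cardS by simp
    moreover have "card (odd_comps ?E (?V - S)) \<le> card S"
      using matchable_imp_card_odd_comps_le[OF sym irrefl _ matchV SV] by simp
    ultimately have "barrier G S"
      using pmG SV by (simp add: barrier_def card_odd_components_delete_verts)
    moreover have "isolated_vertex (delete_verts G S) u"
      using S assms(4) N by (auto simp: isolated_vertex_def neighbours_def dominates_delete_verts)
    ultimately show "\<exists>S. barrier G S \<and> isolated_vertex (delete_verts G S) u" by blast
  next
    assume "\<exists>S. barrier G S \<and> isolated_vertex (delete_verts G S) u"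
    then obtain S where bar: "barrier G S" and iso: "isolated_vertex (delete_verts G S) u" by blast
    have SV: "S \<subseteq> ?V" and cardS: "card (odd_comps ?E (?V - S)) = card S"
      using bar by (auto simp: barrier_def card_odd_components_delete_verts)
    have uS: "u \<notin> S" using iso by (simp add: isolated_vertex_def)
    have NS: "N \<subseteq> S"
      using iso N by (auto simp: isolated_vertex_def neighbours_def dominates_delete_verts)
    show "\<not> nice G u"
    proof
      assume "nice G u"
      \<comment> \<open>The left side equals \<open>card S - 1\<close>, as only the component
        \<open>{u}\<close> is lost, while the right side is \<open>card S - 3\<close>.\<close>
      then have "card (odd_comps ?E (U - (S - N))) \<le> card (S - N)"
        using nice SV uS
        by (intro matchable_imp_card_odd_comps_le[OF sym irrefl]) (auto simp: U_def)
      moreover have "U - (S - N) = ?V - S - {u}" using NS by (auto simp: U_def)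
      ultimately have "card (odd_comps ?E (?V - S - {u})) \<le> card (S - N)" by (simp only:)
      moreover have "card (S - N) = card S - card N" using finN NS by (rule card_Diff_subset)
      moreover have "finite S" using SV by (rule finite_subset) simp
      \<comment> \<open>This keeps the subtraction of natural numbers from being truncated.\<close>
      then have "card N \<le> card S" using NS by (rule card_mono)
      ultimately show False using count[OF NS uS] cardS cardN by linarith
    qed
  qed
qed

end
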